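(* Let $\lambda>1$ and $0<s<\sqrt{\lambda}-1$, let $(T_k)_{k\ge2}$ be the Shearer sequence for $\lambda$ (and $s$), and for each $k$ let $\varepsilon_k$ be the smallest positive root of the function $b_k(\varepsilon)$ attached to the last back node of $T_k$ (defined in the context). Then $\lim_{k\to\infty}\rho(M_{T_k}(s))=\lambda$ if, and only if, $\varepsilon_k\to0$. In particular, if the sequence $(\beta_j)_{j\in\mathbb{N}}$ given by \[ \beta_1=\frac{1+r_1s^2\frac{1}{(\lambda-1)^2}}{\lambda-1-r_1\delta},\qquad \beta_j=c_j+\gamma_j\beta_{j-1}\quad (j\ge2), \] with $c_j:=\dfrac{1+r_js^2\frac{1}{(\lambda-1)^2}}{-b_j}>0$ and $\gamma_j:=\dfrac{s^2}{b_{j-1}b_j}>0$ for $j\ge2$, is unbounded, then $\varepsilon_k\to0$ (so that $\lim_{k\to\infty}\rho(M_{T_k}(s))=\lambda$).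
   Context: For a finite simple undirected graph $G$ with adjacency matrix $A$ and diagonal degree matrix $D$, and $s\in\mathbb{R}$, the deformed Laplacian matrix is $M_G(s)=I-sA+s^2(D-I)$; $\rho(M_G(s))$ denotes its spectral radius. For $k\ge2$ and integers $r_i\ge0$, the caterpillar $[r_1,\dots,r_k]$ is the tree consisting of a path $v_1,\dots,v_k$ (the back nodes) in which $v_i$ has additionally $r_i$ pendant vertices attached, $1\le i\le k$. Put \[ \delta=\frac{s^2\lambda}{\lambda-1},\qquad \varphi(t)=1+s^2-\lambda-\frac{s^2}{t}\ (t\ne0),\qquad \theta'=\frac{(1+s^2-\lambda)+\sqrt{(1+s^2-\lambda)^2-4s^2}}{2}. \] Shearer sequence: define infinite sequences $(r_j)_{j\ge1}$, $(b_j)_{j\ge1}$ recursively by \[ r_1=\lfloor\delta^{-1}(\theta'+\lambda-1)\rfloor,\quad b_1=1-\lambda+r_1\delta, \] \[ r_j=\lfloor\delta^{-1}(\theta'-\varphi(b_{j-1}))\rfloor,\quad b_j=\varphi(b_{j-1})+r_j\delta\quad(j\ge2). \] For $k\ge2$ put $r_k^{\mathrm{end}}=\lfloor\delta^{-1}(\theta'-\varphi(b_{k-1})+s^2)\rfloor$ and $T_k=[r_1,\dots,r_{k-1},r_k^{\mathrm{end}}]$. The sequence $(T_k)_{k\ge2}$ is the Shearer sequence for $\lambda$ (and $s$). Functions $b_j(\varepsilon)$: let \[ \delta(\varepsilon)=s^2\frac{\lambda-\varepsilon}{\lambda-\varepsilon-1},\qquad \varphi_\varepsilon(t)=1+s^2-\lambda+\varepsilon-\frac{s^2}{t}.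 \] For the caterpillar $T_k$ define, as (rational) functions of $\varepsilon$, \[ b_1(\varepsilon)=1-\lambda+\varepsilon+r_1\delta(\varepsilon),\qquad b_j(\varepsilon)=\varphi_\varepsilon(b_{j-1}(\varepsilon))+r_j\delta(\varepsilon)\ (2\le j\le k-1), \] \[ b_k(\varepsilon)=-s^2+\varphi_\varepsilon(b_{k-1}(\varepsilon))+r_k^{\mathrm{end}}\delta(\varepsilon). \] These are the values produced at the back nodes $v_1,\dots,v_k$ by the tree diagonalization algorithm (processing leaves first and then $v_1,\dots,v_k$ in order) applied to $M_{T_k}(s)-(\lambda-\varepsilon)I$, and $\varepsilon_k$ is the smallest positive root of the last one. *)

theory Defs
  imports
    "HOL-Analysis.Analysis"
    "Graph_Theory.Pair_Digraph"
    "Jordan_Normal_Form.Spectral_Radius"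
begin

section \<open>The deformed Laplacian of a finite simple graph\<close>

text \<open>
  A finite simple undirected graph is a \<open>pair_graph\<close>: a finite loop-free digraph in which every
  edge occurs as two opposite arcs. Hence \<open>out_degree\<close> is the degree. Matrices are taken
  with respect to an enumeration \<open>vs\<close> of the vertices.
\<close>

definition adjacency_matrix :: "'v list \<Rightarrow> 'v pair_pre_digraph \<Rightarrow> real mat" where
  "adjacency_matrix vs G =
     mat (length vs) (length vs) (\<lambda>(i, j). if (vs ! i, vs ! j) \<in> parcs G then 1 else 0)"

definition degree_matrix :: "'v list \<Rightarrow> 'v pair_pre_digraph \<Rightarrow> real mat" where
  "degree_matrix vs G =
     mat (length vs) (length vs)
       (\<lambda>(i, j). if i = j then real (out_degree (with_proj G) (vs ! i)) else 0)"

definition deformed_laplacian :: "'v list \<Rightarrow> 'v pair_pre_digraph \<Rightarrow> real \<Rightarrow> real mat" where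
  "deformed_laplacian vs G s =
     1\<^sub>m (length vs) - s \<cdot>\<^sub>m adjacency_matrix vs G
       + s\<^sup>2 \<cdot>\<^sub>m (degree_matrix vs G - 1\<^sub>m (length vs))"

text \<open>
  Two enumerations of the vertices give matrices that are conjugate by a permutation matrix, so
  the choice below does not affect the spectral radius.
\<close>

definition deformed_laplacian_radius :: "'v pair_pre_digraph \<Rightarrow> real \<Rightarrow> real" where
  "deformed_laplacian_radius G s =
     spectral_radius (map_mat complex_of_real
       (deformed_laplacian (SOME vs. distinct vs \<and> set vs = pverts G) G s))"


section \<open>Caterpillars\<close>

text \<open>
  In the caterpillar \<open>[rs ! 0, \<dots>, rs ! (k - 1)]\<close> the back nodes are the vertices \<open>(i, 0)\<close> with
  \<open>i < k\<close>, and the pendant vertices at \<open>(i, 0)\<close> are the \<open>(i, m)\<close> with \<open>1 \<le> m \<le> rs ! i\<close>.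
\<close>

definition caterpillar_edges :: "nat list \<Rightarrow> ((nat \<times> nat) \<times> (nat \<times> nat)) set" where
  "caterpillar_edges rs =
     {((i, 0), (Suc i, 0)) | i. Suc i < length rs} \<union>
     {((i, 0), (i, m)) | i m. i < length rs \<and> 1 \<le> m \<and> m \<le> rs ! i}"

definition caterpillar :: "nat list \<Rightarrow> (nat \<times> nat) pair_pre_digraph" where
  "caterpillar rs =
     \<lparr> pverts = {(i, m). i < length rs \<and> m \<le> rs ! i},
       parcs = caterpillar_edges rs \<union> (caterpillar_edges rs)\<inverse> \<rparr>"

lemma pair_graph_caterpillar: "pair_graph (caterpillar rs)"
proof
  have "pverts (caterpillar rs) = Sigma {..<length rs} (\<lambda>i. {..rs ! i})"
    by (auto simp: caterpillar_def)
  then show fin: "finite (pverts (caterpillar rs))" by simp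
  have sub: "parcs (caterpillar rs) \<subseteq> pverts (caterpillar rs) \<times> pverts (caterpillar rs)"
    by (auto simp: caterpillar_def caterpillar_edges_def)
  then show "finite (parcs (caterpillar rs))"
    using fin by (meson finite_SigmaI finite_subset)
  show "fst e \<in> pverts (caterpillar rs)" "snd e \<in> pverts (caterpillar rs)"
    if "e \<in> parcs (caterpillar rs)" for e
    using sub that by auto
  show "fst e \<noteq> snd e" if "e \<in> parcs (caterpillar rs)" for e
    using that by (auto simp: caterpillar_def caterpillar_edges_def)
  show "symmetric (with_proj (caterpillar rs))"
    by (auto simp: symmetric_def arcs_ends_def arc_to_ends_def caterpillar_def intro!: symI)
qed


section \<open>The Shearer sequence\<close>

definition shearer_delta :: "real \<Rightarrow> real \<Rightarrow> real" where
  "shearer_delta s lam = s\<^sup>2 * lam / (lam - 1)"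

definition shearer_phi :: "real \<Rightarrow> real \<Rightarrow> real \<Rightarrow> real" where
  "shearer_phi s lam t = 1 + s\<^sup>2 - lam - s\<^sup>2 / t"

definition shearer_theta' :: "real \<Rightarrow> real \<Rightarrow> real" where
  "shearer_theta' s lam = ((1 + s\<^sup>2 - lam) + sqrt ((1 + s\<^sup>2 - lam)\<^sup>2 - 4 * s\<^sup>2)) / 2"

text \<open>All sequences are indexed from 1; the value at index 0 is a dummy.\<close>

fun shearer_r :: "real \<Rightarrow> real \<Rightarrow> nat \<Rightarrow> int"
  and shearer_b :: "real \<Rightarrow> real \<Rightarrow> nat \<Rightarrow> real" where
  "shearer_r s lam 0 = 0"
| "shearer_r s lam (Suc 0) = \<lfloor>(shearer_theta' s lam + lam - 1) / shearer_delta s lam\<rfloor>"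
| "shearer_r s lam (Suc (Suc n)) =
     \<lfloor>(shearer_theta' s lam - shearer_phi s lam (shearer_b s lam (Suc n))) / shearer_delta s lam\<rfloor>"
| "shearer_b s lam 0 = 0"
| "shearer_b s lam (Suc 0) =
     1 - lam + of_int (shearer_r s lam (Suc 0)) * shearer_delta s lam"
| "shearer_b s lam (Suc (Suc n)) =
     shearer_phi s lam (shearer_b s lam (Suc n))
       + of_int (shearer_r s lam (Suc (Suc n))) * shearer_delta s lam"

definition shearer_r_end :: "real \<Rightarrow> real \<Rightarrow> nat \<Rightarrow> int" where
  "shearer_r_end s lam k =
     \<lfloor>(shearer_theta' s lam - shearer_phi s lam (shearer_b s lam (k - 1)) + s\<^sup>2)
        / shearer_delta s lam\<rfloor>"

text \<open>
  For \<open>lam > 1\<close> and \<open>0 < s < sqrt lam - 1\<close> the integers \<open>r\<^sub>j\<close> and \<open>r\<^sub>k\<close>-end are nonnegative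
  (see \<open>shearer_r_nonneg\<close> and \<open>shearer_r_end_nonneg\<close> below), so that \<open>nat\<close> is a mere type
  conversion here.
\<close>

definition shearer_caterpillar :: "real \<Rightarrow> real \<Rightarrow> nat \<Rightarrow> (nat \<times> nat) pair_pre_digraph" where
  "shearer_caterpillar s lam k =
     caterpillar (map (\<lambda>j. nat (shearer_r s lam j)) [1..<k] @ [nat (shearer_r_end s lam k)])"

lemma shearer_theta'_bounds:
  assumes "lam > 1" "0 < s" "s < sqrt lam - 1"
  shows "1 - lam \<le> shearer_theta' s lam" "shearer_theta' s lam < 0"
    "shearer_phi s lam (shearer_theta' s lam) = shearer_theta' s lam"
proof -
  define p where "p = 1 + s\<^sup>2 - lam"
  define q where "q = sqrt (p\<^sup>2 - 4 * s\<^sup>2)"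
  have th: "shearer_theta' s lam = (p + q) / 2"
    by (simp add: shearer_theta'_def p_def q_def)
  have "(1 + s)\<^sup>2 < (sqrt lam)\<^sup>2"
    using assms by (intro power_strict_mono) auto
  then have p: "p < - (2 * s)"
    using assms by (simp add: p_def power2_eq_square algebra_simps)
  have "(2 * s)\<^sup>2 < (- p)\<^sup>2"
    using p assms by (intro power_strict_mono) auto
  then have disc: "p\<^sup>2 - 4 * s\<^sup>2 > 0" by (simp add: power_mult_distrib)
  then have q: "q > 0" "q\<^sup>2 = p\<^sup>2 - 4 * s\<^sup>2" by (simp_all add: q_def)
  have "q\<^sup>2 < (- p)\<^sup>2" using q assms by simp
  then have "q < - p" using p assms power_less_imp_less_base[of q 2 "- p"] by simp
  then show neg: "shearer_theta' s lam < 0" by (simp add: th)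
  have "2 - 2 * lam \<le> p"
    using assms(1) zero_le_power2[of s] unfolding p_def by linarith
  then have "1 - lam \<le> p / 2" by (simp add: field_simps)
  then show "1 - lam \<le> shearer_theta' s lam" using q by (simp add: th)
  have "(p + q) / 2 * ((p + q) / 2) = p * ((p + q) / 2) - s\<^sup>2"
    using q(2) by (simp add: power2_eq_square field_simps)
  then have "p - s\<^sup>2 / ((p + q) / 2) = (p + q) / 2"
    using neg unfolding th by (simp add: divide_simps)
  then show "shearer_phi s lam (shearer_theta' s lam) = shearer_theta' s lam"
    by (simp add: shearer_phi_def th p_def)
qed

lemma shearer_phi_le_theta':
  assumes "lam > 1" "0 < s" "s < sqrt lam - 1" "t \<le> shearer_theta' s lam"
  shows "shearer_phi s lam t \<le> shearer_theta' s lam"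
proof -
  note th = shearer_theta'_bounds[OF assms(1-3)]
  have "inverse (shearer_theta' s lam) \<le> inverse t"
    using assms(4) th(2) by (simp add: le_imp_inverse_le_neg)
  then have "s\<^sup>2 * inverse (shearer_theta' s lam) \<le> s\<^sup>2 * inverse t"
    by (intro mult_left_mono) auto
  then have "shearer_phi s lam t \<le> shearer_phi s lam (shearer_theta' s lam)"
    by (simp add: shearer_phi_def field_class.field_divide_inverse)
  then show ?thesis using th(3) by simp
qed

lemma shearer_delta_pos: "lam > 1 \<Longrightarrow> 0 < s \<Longrightarrow> shearer_delta s lam > 0"
  by (simp add: shearer_delta_def)

lemma shearer_b_le_theta':
  assumes "lam > 1" "0 < s" "s < sqrt lam - 1"
  shows "shearer_b s lam (Suc n) \<le> shearer_theta' s lam"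
proof -
  have le: "x + of_int \<lfloor>(shearer_theta' s lam - x) / shearer_delta s lam\<rfloor> * shearer_delta s lam
      \<le> shearer_theta' s lam" for x
    using of_int_floor_le[of "(shearer_theta' s lam - x) / shearer_delta s lam"]
      shearer_delta_pos[OF assms(1,2)] by (simp add: pos_le_divide_eq del: of_int_floor_le)
  show ?thesis
    using le[of "1 - lam"] le[of "shearer_phi s lam (shearer_b s lam n)"]
    by (cases n) (simp_all add: algebra_simps le)
qed

lemma shearer_r_nonneg:
  assumes "lam > 1" "0 < s" "s < sqrt lam - 1"
  shows "shearer_r s lam j \<ge> 0"
proof -
  note pos = shearer_delta_pos[OF assms(1,2)]
  consider "j = 0" | "j = Suc 0" | n where "j = Suc (Suc n)"
    by (metis not0_implies_Suc)
  then show ?thesis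
  proof cases
    case 2
    then show ?thesis using shearer_theta'_bounds(1)[OF assms] pos by simp
  next
    case 3
    then show ?thesis
      using shearer_phi_le_theta'[OF assms shearer_b_le_theta'[OF assms]] pos by simp
  qed simp
qed

lemma shearer_r_end_nonneg:
  assumes "lam > 1" "0 < s" "s < sqrt lam - 1" "k \<ge> 2"
  shows "shearer_r_end s lam k \<ge> 0"
proof -
  obtain n where k: "k - 1 = Suc n" using assms(4) by (cases "k - 1") auto
  show ?thesis
    using shearer_phi_le_theta'[OF assms(1-3) shearer_b_le_theta'[OF assms(1-3), of n]]
      shearer_delta_pos[OF assms(1,2)] zero_le_power2[of s]
    unfolding shearer_r_end_def k by simp
qed


section \<open>The functions \<open>b\<^sub>j(\<epsilon>)\<close> and their smallest positive root\<close>

text \<open>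
  \<open>\<delta>(\<epsilon>)\<close> and \<open>\<phi>\<^sub>\<epsilon>\<close> are \<open>\<delta>\<close> and \<open>\<phi>\<close> with \<open>lam - \<epsilon>\<close> in place of \<open>lam\<close>; the integers \<open>r\<^sub>j\<close> remain those
  of \<open>lam\<close>. The function at the back node \<open>j < k\<close> of the \<open>k\<close>-th caterpillar does not depend on \<open>k\<close>.
\<close>

fun shearer_b_eps :: "real \<Rightarrow> real \<Rightarrow> nat \<Rightarrow> real \<Rightarrow> real" where
  "shearer_b_eps s lam 0 e = 0"
| "shearer_b_eps s lam (Suc 0) e =
     1 - lam + e + of_int (shearer_r s lam (Suc 0)) * shearer_delta s (lam - e)"
| "shearer_b_eps s lam (Suc (Suc n)) e =
     shearer_phi s (lam - e) (shearer_b_eps s lam (Suc n) e)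
       + of_int (shearer_r s lam (Suc (Suc n))) * shearer_delta s (lam - e)"

definition shearer_b_last :: "real \<Rightarrow> real \<Rightarrow> nat \<Rightarrow> real \<Rightarrow> real" where
  "shearer_b_last s lam k e =
     - (s\<^sup>2) + shearer_phi s (lam - e) (shearer_b_eps s lam (k - 1) e)
       + of_int (shearer_r_end s lam k) * shearer_delta s (lam - e)"

text \<open>
  The \<open>b\<^sub>j(\<epsilon>)\<close> are rational functions, and HOL division by zero would assign them values at points
  where the defining expressions are undefined: \<open>\<epsilon> = lam - 1\<close>, and the zeros of the preceding
  functions. Such points are not counted as roots.
\<close>

definition shearer_b_last_root :: "real \<Rightarrow> real \<Rightarrow> nat \<Rightarrow> real \<Rightarrow> bool" where
  "shearer_b_last_root s lam k e \<longleftrightarrow>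
     e \<noteq> lam - 1 \<and> (\<forall>j\<in>{1..<k}. shearer_b_eps s lam j e \<noteq> 0) \<and> shearer_b_last s lam k e = 0"

definition shearer_eps :: "real \<Rightarrow> real \<Rightarrow> nat \<Rightarrow> real" where
  "shearer_eps s lam k = (LEAST e. e > 0 \<and> shearer_b_last_root s lam k e)"


section \<open>The sequence \<open>\<beta>\<^sub>j\<close>\<close>

definition shearer_c :: "real \<Rightarrow> real \<Rightarrow> nat \<Rightarrow> real" where
  "shearer_c s lam j =
     (1 + of_int (shearer_r s lam j) * s\<^sup>2 * (1 / (lam - 1)\<^sup>2)) / (- shearer_b s lam j)"

definition shearer_gamma :: "real \<Rightarrow> real \<Rightarrow> nat \<Rightarrow> real" where
  "shearer_gamma s lam j = s\<^sup>2 / (shearer_b s lam (j - 1) * shearer_b s lam j)"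

fun shearer_beta :: "real \<Rightarrow> real \<Rightarrow> nat \<Rightarrow> real" where
  "shearer_beta s lam 0 = 0"
| "shearer_beta s lam (Suc 0) =
     (1 + of_int (shearer_r s lam 1) * s\<^sup>2 * (1 / (lam - 1)\<^sup>2))
       / (lam - 1 - of_int (shearer_r s lam 1) * shearer_delta s lam)"
| "shearer_beta s lam (Suc (Suc n)) =
     shearer_c s lam (Suc (Suc n)) + shearer_gamma s lam (Suc (Suc n)) * shearer_beta s lam (Suc n)"

end

theory Submission
  imports Defs
begin

text \<open>
  The whole theorem follows from an exact formula for the spectral radius of the \<open>k\<close>-th
  caterpillar, valid for every \<open>k \<ge> 2\<close>: it equals \<open>lam - \<epsilon>\<^sub>k\<close>
  (\<open>deformed_laplacian_radius_shearer\<close>). The equivalence of the two limits is then immediate.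

  The formula has an analytic and a spectral half. Analytically, all \<open>b\<^sub>j(0)\<close> are negative. Each
  \<open>b\<^sub>j(\<epsilon>)\<close> has the form \<open>h(\<epsilon>) - s\<^sup>2 / b\<^sub>j\<^sub>-\<^sub>1(\<epsilon>)\<close> with \<open>h\<close> increasing. As long as \<open>b\<^sub>j\<^sub>-\<^sub>1\<close> is negative
  and increasing, so is the subtracted term, and the difference blows up at the first zero of
  \<open>b\<^sub>j\<^sub>-\<^sub>1\<close>. Hence \<open>b\<^sub>j\<close> rises strictly and reaches zero before \<open>b\<^sub>j\<^sub>-\<^sub>1\<close> does
  (\<open>increases_to_zero_step\<close>). So the first zeros decrease strictly with \<open>j\<close>; the last function
  has a least positive root \<open>\<epsilon>\<^sub>k < lam - 1\<close>, at which all earlier \<open>b\<^sub>j\<close> are still negative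
  (\<open>shearer_eps_least_root\<close>).

  Spectrally, put \<open>\<mu> = lam - \<epsilon>\<^sub>k\<close>. A caterpillar is bipartite, so changing signs on one colour class
  turns \<open>I - s A + s\<^sup>2 (D - I)\<close> into the entrywise nonnegative matrix \<open>I + s A + s\<^sup>2 (D - I)\<close>. Back
  substitution in the diagonalization at \<open>\<mu>\<close> gives an eigenvector of the latter for \<open>\<mu>\<close>, whose
  successive ratios along the back nodes are \<open>- b\<^sub>j / s\<close>. They are positive, because the last \<open>b\<close>
  vanishes and the others are negative. A nonnegative matrix with a positive eigenvector has the
  corresponding eigenvalue as its spectral radius
  (\<open>deformed_laplacian_radius_eqI\<close>, \<open>deformed_laplacian_radius_caterpillar_eqI\<close>).

  Finally \<open>\<beta>\<^sub>j\<close> is the relative slope \<open>b\<^sub>j'(0) / (- b\<^sub>j(0))\<close>, and \<open>b\<^sub>j\<close> is convex as long as it and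
  its predecessors are negative, so there it lies above its tangent \<open>b\<^sub>j(0) (1 - \<epsilon> \<beta>\<^sub>j)\<close> at 0
  (\<open>shearer_b_eps_tangent\<close>). Evaluating at \<open>\<epsilon>\<^sub>k\<close>, where \<open>b\<^sub>j\<close> is negative, gives \<open>\<epsilon>\<^sub>k \<beta>\<^sub>j < 1\<close> for all
  \<open>j < k\<close>, and an unbounded \<open>\<beta>\<close> forces \<open>\<epsilon>\<^sub>k \<rightarrow> 0\<close>.
\<close>

section \<open>Positive vectors and the spectral radius\<close>

definition neighbours :: "'v pair_pre_digraph \<Rightarrow> 'v \<Rightarrow> 'v set" where
  "neighbours G u = {w. (u, w) \<in> parcs G}"

lemma out_degree_eq_card_neighbours: "out_degree (with_proj G) u = card (neighbours G u)"
proof -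
  have "out_arcs (with_proj G) u = Pair u ` neighbours G u"
    by (auto simp: out_arcs_def neighbours_def)
  then show ?thesis by (simp add: out_degree_def card_image inj_on_def)
qed

text \<open>
  The easy half of Perron--Frobenius: measure an eigenvector in the sup norm weighted by \<open>x\<close>, and
  read the eigenvalue equation in a row where that norm is attained.
\<close>

lemma norm_eigenvalue_le_of_positive_vector:
  fixes A :: "complex mat" and x :: "nat \<Rightarrow> real"
  assumes A: "A \<in> carrier_mat n n" and ev: "eigenvalue A a"
    and pos: "\<And>i. i < n \<Longrightarrow> 0 < x i"
    and le: "\<And>i. i < n \<Longrightarrow> (\<Sum>j<n. cmod (A $$ (i, j)) * x j) \<le> \<mu> * x i"
  shows "cmod a \<le> \<mu>"
proof -
  obtain v where v: "v \<in> carrier_vec n" "v \<noteq> 0\<^sub>v n" "A *\<^sub>v v = a \<cdot>\<^sub>v v"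
    using ev A by (auto simp: eigenvalue_def eigenvector_def)
  obtain j0 where j0: "j0 < n" "vec_index v j0 \<noteq> 0"
    using v(1,2) by (metis carrier_vecD eq_vecI index_zero_vec)
  define q where "q = (\<lambda>i. cmod (vec_index v i) / x i)"
  have "Max (q ` {..<n}) \<in> q ` {..<n}"
    using j0 by (intro Max_in) auto
  then obtain i where i: "i < n" "q i = Max (q ` {..<n})" by auto
  have max: "q j \<le> q i" if "j < n" for j
    using that by (simp add: i(2))
  have vq: "cmod (vec_index v j) = q j * x j" if "j < n" for j
    using pos[OF that] by (simp add: q_def)
  have "q j0 > 0" using j0 pos by (simp add: q_def)
  then have q: "q i > 0" using max[OF j0(1)] by simp
  have "a * vec_index v i = vec_index (A *\<^sub>v v) i"
    using v i(1) by simp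
  also have "\<dots> = (\<Sum>j<n. A $$ (i, j) * vec_index v j)"
    using A v(1) i(1) by (simp add: scalar_prod_def atLeast0LessThan)
  finally have "cmod a * cmod (vec_index v i) = cmod (\<Sum>j<n. A $$ (i, j) * vec_index v j)"
    by (metis norm_mult)
  also have "\<dots> \<le> (\<Sum>j<n. cmod (A $$ (i, j)) * (q i * x j))"
    using max pos
    by (intro sum_norm_le)
      (simp add: norm_mult vq mult_left_mono mult_right_mono less_imp_le)
  also have "\<dots> = q i * (\<Sum>j<n. cmod (A $$ (i, j)) * x j)"
    by (simp add: sum_distrib_left mult_ac)
  also have "\<dots> \<le> q i * (\<mu> * x i)"
    using q le[OF i(1)] by (intro mult_left_mono) auto
  also have "\<dots> = \<mu> * cmod (vec_index v i)" using vq[OF i(1)] by simp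
  finally show ?thesis using q pos[OF i(1)] vq[OF i(1)] by simp
qed

text \<open>
  Both the matrix and its entrywise absolute value act by a neighbour sum. For the absolute value
  this relies on the graph having no loops, so that no entry mixes a degree term with an adjacency
  term.
\<close>

lemma deformed_laplacian_row_sum:
  fixes f :: "'v \<Rightarrow> real"
  assumes G: "pair_graph G" and vs: "distinct vs" "set vs = pverts G" and i: "i < length vs"
  shows "(\<Sum>j<length vs. deformed_laplacian vs G s $$ (i, j) * f (vs ! j))
    = (1 + s\<^sup>2 * (real (out_degree (with_proj G) (vs ! i)) - 1)) * f (vs ! i)
      - s * (\<Sum>w\<in>neighbours G (vs ! i). f w)"
    and "(\<Sum>j<length vs. \<bar>deformed_laplacian vs G s $$ (i, j)\<bar> * f (vs ! j))
    = \<bar>1 + s\<^sup>2 * (real (out_degree (with_proj G) (vs ! i)) - 1)\<bar> * f (vs ! i)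
      + \<bar>s\<bar> * (\<Sum>w\<in>neighbours G (vs ! i). f w)"
proof -
  interpret pair_graph G by (rule G)
  define n u where "n = length vs" and "u = vs ! i"
  define d where "d = 1 + s\<^sup>2 * (real (out_degree (with_proj G) u) - 1)"
  have entry: "deformed_laplacian vs G s $$ (i, j) =
      (if j = i then d else 0) + (if vs ! j \<in> neighbours G u then - s else 0)" if "j < n" for j
    using that i vs
    by (auto simp: deformed_laplacian_def adjacency_matrix_def degree_matrix_def n_def d_def u_def
        neighbours_def algebra_simps)
  have loop: "u \<notin> neighbours G u" by (auto simp: neighbours_def dest: no_loops)
  have bij: "bij_betw (\<lambda>j. vs ! j) {..<n} (pverts G)"
    using vs bij_betw_nth[of vs "{..<n}" "pverts G"] by (simp add: n_def)
  have sub: "neighbours G u \<subseteq> pverts G"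
    by (auto simp: neighbours_def dest: in_arcsD2)
  have nsum: "(\<Sum>j<n. if vs ! j \<in> neighbours G u then c * f (vs ! j) else 0)
      = c * (\<Sum>w\<in>neighbours G u. f w)" for c
  proof -
    have "(\<Sum>j<n. if vs ! j \<in> neighbours G u then c * f (vs ! j) else 0)
        = (\<Sum>w\<in>pverts G. if w \<in> neighbours G u then c * f w else 0)"
      by (rule sum.reindex_bij_betw[OF bij])
    also have "\<dots> = (\<Sum>w\<in>neighbours G u. c * f w)"
      using sub by (simp add: sum.If_cases Int_absorb1)
    finally show ?thesis by (simp add: sum_distrib_left)
  qed
  have "(\<Sum>j<n. deformed_laplacian vs G s $$ (i, j) * f (vs ! j)) =
      (\<Sum>j<n. (if j = i then d * f u else 0)
        + (if vs ! j \<in> neighbours G u then - s * f (vs ! j) else 0))"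
    by (intro sum.cong) (auto simp: entry u_def algebra_simps)
  also have "\<dots> = d * f u - s * (\<Sum>w\<in>neighbours G u. f w)"
    using i by (simp only: sum.distrib nsum) (simp add: n_def)
  finally show "(\<Sum>j<length vs. deformed_laplacian vs G s $$ (i, j) * f (vs ! j))
    = (1 + s\<^sup>2 * (real (out_degree (with_proj G) (vs ! i)) - 1)) * f (vs ! i)
      - s * (\<Sum>w\<in>neighbours G (vs ! i). f w)" by (simp add: n_def d_def u_def)
  have "(\<Sum>j<n. \<bar>deformed_laplacian vs G s $$ (i, j)\<bar> * f (vs ! j)) =
      (\<Sum>j<n. (if j = i then \<bar>d\<bar> * f u else 0)
        + (if vs ! j \<in> neighbours G u then \<bar>s\<bar> * f (vs ! j) else 0))"
    using loop by (intro sum.cong) (auto simp: entry u_def algebra_simps)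
  also have "\<dots> = \<bar>d\<bar> * f u + \<bar>s\<bar> * (\<Sum>w\<in>neighbours G u. f w)"
    using i by (simp only: sum.distrib nsum) (simp add: n_def)
  finally show "(\<Sum>j<length vs. \<bar>deformed_laplacian vs G s $$ (i, j)\<bar> * f (vs ! j))
    = \<bar>1 + s\<^sup>2 * (real (out_degree (with_proj G) (vs ! i)) - 1)\<bar> * f (vs ! i)
      + \<bar>s\<bar> * (\<Sum>w\<in>neighbours G (vs ! i). f w)" by (simp add: n_def d_def u_def)
qed

text \<open>
  The function \<open>\<sigma>\<close> is a two-colouring of the graph, written with the colours 1 and -1. The
  positive vector \<open>x\<close> bounds every eigenvalue by \<open>\<mu>\<close>, and the product \<open>\<sigma> x\<close> is an eigenvector of the
  deformed Laplacian itself, so that the bound is attained. Without isolated vertices the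
  diagonal entries are positive for every \<open>s\<close>.
\<close>

lemma deformed_laplacian_radius_eqI:
  fixes x \<sigma> :: "'v \<Rightarrow> real"
  assumes G: "pair_graph G" and ne: "pverts G \<noteq> {}" and s: "0 \<le> s" and \<mu>: "0 \<le> \<mu>"
    and deg: "\<And>u. u \<in> pverts G \<Longrightarrow> 1 \<le> out_degree (with_proj G) u"
    and sign: "\<And>u. u \<in> pverts G \<Longrightarrow> \<bar>\<sigma> u\<bar> = 1" "\<And>u w. (u, w) \<in> parcs G \<Longrightarrow> \<sigma> w = - \<sigma> u"
    and pos: "\<And>u. u \<in> pverts G \<Longrightarrow> 0 < x u"
    and eq: "\<And>u. u \<in> pverts G \<Longrightarrow>
      (1 + s\<^sup>2 * (real (out_degree (with_proj G) u) - 1)) * x u + s * (\<Sum>w\<in>neighbours G u. x w)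
        = \<mu> * x u"
  shows "deformed_laplacian_radius G s = \<mu>"
proof -
  interpret pair_graph G by (rule G)
  define vs where "vs = (SOME vs. distinct vs \<and> set vs = pverts G)"
  have "\<exists>vs. distinct vs \<and> set vs = pverts G"
    using finite_distinct_list[OF pair_finite_verts] by auto
  from someI_ex[OF this] have vs: "distinct vs" "set vs = pverts G"
    by (simp_all add: vs_def)
  define n where "n = length vs"
  have n: "n > 0" using ne vs(2) by (cases vs) (auto simp: n_def)
  have vert: "vs ! i \<in> pverts G" if "i < n" for i
    using nth_mem[of i vs] that vs(2) by (simp add: n_def)
  define D where "D = deformed_laplacian vs G s"
  define A where "A = map_mat complex_of_real D"
  have D: "D \<in> carrier_mat n n"
    unfolding D_def deformed_laplacian_def adjacency_matrix_def degree_matrix_def n_def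
    by (intro add_carrier_mat smult_carrier_mat minus_carrier_mat mat_carrier one_carrier_mat)
  then have A: "A \<in> carrier_mat n n" by (simp add: A_def)
  have entry: "A $$ (i, j) = complex_of_real (D $$ (i, j))" if "i < n" "j < n" for i j
    using that D by (simp add: A_def)
  have upper: "cmod a \<le> \<mu>" if "eigenvalue A a" for a
  proof (rule norm_eigenvalue_le_of_positive_vector[OF A that, of "\<lambda>i. x (vs ! i)"])
    show "0 < x (vs ! i)" if "i < n" for i using pos vert that by simp
    show "(\<Sum>j<n. cmod (A $$ (i, j)) * x (vs ! j)) \<le> \<mu> * x (vs ! i)" if "i < n" for i
    proof -
      have "0 \<le> s\<^sup>2 * (real (out_degree (with_proj G) (vs ! i)) - 1)"
        using deg[OF vert[OF that]] by (intro mult_nonneg_nonneg) auto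
      then show ?thesis
        using deformed_laplacian_row_sum(2)[OF G vs, of i s x] eq[OF vert[OF that]] that s
        by (simp add: entry D_def n_def)
    qed
  qed
  have "eigenvalue A (complex_of_real \<mu>)"
  proof -
    define y where "y = vec n (\<lambda>i. complex_of_real (\<sigma> (vs ! i) * x (vs ! i)))"
    have y: "y \<in> carrier_vec n" by (simp add: y_def)
    have "vec_index y 0 \<noteq> 0"
      using n sign(1)[OF vert[OF n]] pos[OF vert[OF n]] by (auto simp: y_def)
    then have "y \<noteq> 0\<^sub>v n" using n by auto
    moreover have "A *\<^sub>v y = complex_of_real \<mu> \<cdot>\<^sub>v y"
    proof (rule eq_vecI)
      fix i assume "i < dim_vec (complex_of_real \<mu> \<cdot>\<^sub>v y)"
      then have i: "i < n" by (simp add: y_def)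
      define u where "u = vs ! i"
      have "vec_index (A *\<^sub>v y) i = (\<Sum>j<n. A $$ (i, j) * vec_index y j)"
        using A y i by (simp add: scalar_prod_def atLeast0LessThan)
      also have "\<dots> = complex_of_real (\<Sum>j<n. D $$ (i, j) * (\<sigma> (vs ! j) * x (vs ! j)))"
        using i by (simp add: entry y_def)
      also have "(\<Sum>j<n. D $$ (i, j) * (\<sigma> (vs ! j) * x (vs ! j)))
        = (1 + s\<^sup>2 * (real (out_degree (with_proj G) u) - 1)) * (\<sigma> u * x u)
          - s * (\<Sum>w\<in>neighbours G u. \<sigma> w * x w)"
        using deformed_laplacian_row_sum(1)[OF G vs, of i s "\<lambda>w. \<sigma> w * x w"] i
        by (simp add: D_def n_def u_def)
      also have "(\<Sum>w\<in>neighbours G u. \<sigma> w * x w) = - \<sigma> u * (\<Sum>w\<in>neighbours G u. x w)"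
        unfolding sum_distrib_left by (intro sum.cong) (auto simp: neighbours_def sign(2))
      also have "(1 + s\<^sup>2 * (real (out_degree (with_proj G) u) - 1)) * (\<sigma> u * x u)
          - s * (- \<sigma> u * (\<Sum>w\<in>neighbours G u. x w)) = \<sigma> u * (\<mu> * x u)"
        unfolding eq[OF vert[OF i], folded u_def, symmetric] by (simp add: algebra_simps)
      finally show "vec_index (A *\<^sub>v y) i = vec_index (complex_of_real \<mu> \<cdot>\<^sub>v y) i"
        using i by (simp add: y_def u_def)
    qed (use A in \<open>simp add: y_def\<close>)
    ultimately show ?thesis using A y by (auto simp: eigenvalue_def eigenvector_def)
  qed
  then have "\<mu> \<in> norm ` spectrum A"
    using \<mu> by (intro image_eqI[of _ _ "complex_of_real \<mu>"]) (simp_all add: spectrum_def)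
  then have "\<mu> \<le> spectral_radius A" by (rule spectral_radius_mem_max(2)[OF A n])
  moreover have "spectral_radius A \<le> \<mu>"
    using spectral_radius_mem_max(1)[OF A n] upper by (auto simp: spectrum_def)
  ultimately show ?thesis
    by (simp add: deformed_laplacian_radius_def A_def D_def vs_def)
qed

section \<open>The deformed Laplacian of a caterpillar\<close>

lemma arc_caterpillar_iff:
  "((i, m), (j, l)) \<in> parcs (caterpillar rs) \<longleftrightarrow>
    m = 0 \<and> l = 0 \<and> (j = Suc i \<and> j < length rs \<or> i = Suc j \<and> i < length rs) \<or>
    i = j \<and> i < length rs \<and> (m = 0 \<and> 1 \<le> l \<and> l \<le> rs ! i \<or> l = 0 \<and> 1 \<le> m \<and> m \<le> rs ! i)"
  unfolding caterpillar_def caterpillar_edges_def by auto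

lemma neighbours_caterpillar_leaf:
  assumes "i < length rs" "1 \<le> m" "m \<le> rs ! i"
  shows "neighbours (caterpillar rs) (i, m) = {(i, 0)}"
  using assms by (auto simp: neighbours_def arc_caterpillar_iff)

lemma neighbours_caterpillar_back:
  assumes "i < length rs"
  shows "neighbours (caterpillar rs) (i, 0) =
    (if Suc i < length rs then {(Suc i, 0)} else {}) \<union> (if i > 0 then {(i - 1, 0)} else {})
      \<union> Pair i ` {1..rs ! i}"
  using assms by (cases i) (auto simp: neighbours_def arc_caterpillar_iff)

lemma sum_neighbours_caterpillar_back:
  fixes f :: "nat \<times> nat \<Rightarrow> 'a :: comm_monoid_add"
  assumes "i < length rs"
  shows "(\<Sum>w\<in>neighbours (caterpillar rs) (i, 0). f w) =
    (if Suc i < length rs then f (Suc i, 0) else 0) + (if i > 0 then f (i - 1, 0) else 0)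
      + (\<Sum>m=1..rs ! i. f (i, m))"
proof -
  let ?U = "if Suc i < length rs then {(Suc i, 0)} else {} :: (nat \<times> nat) set"
  let ?L = "if i > 0 then {(i - 1, 0)} else {} :: (nat \<times> nat) set"
  have "sum f (?U \<union> ?L \<union> Pair i ` {1..rs ! i}) = sum f ?U + sum f ?L + sum f (Pair i ` {1..rs ! i})"
  proof -
    have "sum f (?U \<union> ?L \<union> Pair i ` {1..rs ! i}) = sum f (?U \<union> ?L) + sum f (Pair i ` {1..rs ! i})"
      by (rule sum.union_disjoint) auto
    also have "sum f (?U \<union> ?L) = sum f ?U + sum f ?L"
      by (rule sum.union_disjoint) auto
    finally show ?thesis .
  qed
  also have "sum f (Pair i ` {1..rs ! i}) = (\<Sum>m=1..rs ! i. f (i, m))"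
    by (subst sum.reindex) (auto simp: inj_on_def)
  finally show ?thesis
    unfolding neighbours_caterpillar_back[OF assms] by (simp split: if_splits)
qed

lemma degree_caterpillar_back:
  assumes "i < length rs"
  shows "out_degree (with_proj (caterpillar rs)) (i, 0) =
    (if Suc i < length rs then 1 else 0) + (if i > 0 then 1 else 0) + rs ! i"
  using sum_neighbours_caterpillar_back[OF assms, of "\<lambda>_. 1 :: nat"]
  by (simp add: out_degree_eq_card_neighbours)

text \<open>
  The values \<open>B i\<close> are the pivots of the tree diagonalization of \<open>M - \<mu> I\<close>, counted from 0, and the
  last pivot is assumed to vanish. Eliminating the variables again gives an eigenvector with
  \<open>x\<^sub>i\<^sub>+\<^sub>1 / x\<^sub>i = - B i / s\<close> along the back nodes and \<open>s x\<^sub>i / (\<mu> - 1)\<close> at the pendant vertices of \<open>i\<close>.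
\<close>

lemma deformed_laplacian_radius_caterpillar_eqI:
  fixes B :: "nat \<Rightarrow> real"
  assumes len: "length rs = n + 2" and s: "0 < s" and \<mu>: "1 < \<mu>"
    and first: "B 0 = 1 - \<mu> + real (rs ! 0) * shearer_delta s \<mu>"
    and inner: "\<And>i. i < n \<Longrightarrow>
      B (Suc i) = shearer_phi s \<mu> (B i) + real (rs ! Suc i) * shearer_delta s \<mu>"
    and neg: "\<And>i. i \<le> n \<Longrightarrow> B i < 0"
    and last: "- (s\<^sup>2) + shearer_phi s \<mu> (B n) + real (rs ! Suc n) * shearer_delta s \<mu> = 0"
  shows "deformed_laplacian_radius (caterpillar rs) s = \<mu>"
proof -
  define X where "X = (\<lambda>i. \<Prod>l<i. - B l / s)"
  have X0: "X 0 = 1" and XS: "X (Suc i) = X i * (- B i / s)" for i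
    by (simp_all add: X_def)
  have Xpos: "X i > 0" if "i < n + 2" for i
    unfolding X_def using that s neg by (intro prod_pos) (auto simp: divide_neg_pos)
  define x where "x = (\<lambda>(i, m :: nat). if m = 0 then X i else s * X i / (\<mu> - 1))"
  define \<sigma> where "\<sigma> = (\<lambda>(i, m). (-1) ^ (if m = (0 :: nat) then i else Suc i) :: real)"
  have \<delta>: "shearer_delta s \<mu> = s\<^sup>2 + s\<^sup>2 / (\<mu> - 1)"
    using \<mu> by (simp add: shearer_delta_def field_simps)
  have leaf_eq: "(1 + s\<^sup>2 * (real (out_degree (with_proj (caterpillar rs)) (i, m)) - 1)) * x (i, m)
      + s * (\<Sum>w\<in>neighbours (caterpillar rs) (i, m). x w) = \<mu> * x (i, m)"
    if "i < n + 2" "m \<noteq> 0" "m \<le> rs ! i" for i m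
  proof -
    have nb: "neighbours (caterpillar rs) (i, m) = {(i, 0)}"
      using neighbours_caterpillar_leaf that len by simp
    show ?thesis
      unfolding out_degree_eq_card_neighbours nb using that \<mu> by (simp add: x_def field_simps)
  qed
  have back_eq: "(1 + s\<^sup>2 * (real (out_degree (with_proj (caterpillar rs)) (i, 0)) - 1)) * x (i, 0)
      + s * (\<Sum>w\<in>neighbours (caterpillar rs) (i, 0). x w) = \<mu> * x (i, 0)"
    if i: "i < n + 2" for i
  proof -
    have deg: "out_degree (with_proj (caterpillar rs)) (i, 0) =
        (if i \<le> n then 1 else 0) + (if i > 0 then 1 else 0) + rs ! i"
      using degree_caterpillar_back[of i rs] i len by simp
    have nb: "(\<Sum>w\<in>neighbours (caterpillar rs) (i, 0). x w) =
        (if i \<le> n then X (Suc i) else 0) + (if i > 0 then X (i - 1) else 0)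
          + real (rs ! i) * (s * X i / (\<mu> - 1))"
      using sum_neighbours_caterpillar_back[of i rs x] i len by (simp add: x_def)
    \<comment> \<open>In units of \<open>X i\<close>, the next back node contributes \<open>- B
        i\<close>, and the previous one cancels the term \<open>s\<^sup>2 / B (i - 1)\<close> of the
        pivot recursion.\<close>
    have up: "s * X (Suc i) = - B i * X i" using s by (simp add: XS)
    have down: "s * X (i - 1) = - (s\<^sup>2 / B (i - 1)) * X i" if pos: "i > 0"
    proof -
      obtain l where l: "i = Suc l" using pos by (cases i) auto
      then have "B l \<noteq> 0" using neg[of l] i by simp
      then show ?thesis using s by (simp add: l XS field_simps power2_eq_square)
    qed
    define r where "r = real (rs ! i)"
    \<comment> \<open>A pendant vertex contributes \<open>s\<^sup>2\<close> through the degree and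
        \<open>s\<^sup>2 / (\<mu> - 1)\<close> through the adjacency, together
        \<open>\<delta>\<close>.\<close>
    have load: "r * s\<^sup>2 * X i + s * (r * (s * X i / (\<mu> - 1))) = r * shearer_delta s \<mu> * X i"
      unfolding \<delta> by (simp add: algebra_simps power2_eq_square)
    consider "i = 0" | l where "i = Suc l" "l < n" | "i = Suc n"
      using i by (cases i) force+
    then show ?thesis
    proof cases
      case 1
      have "(1 + s\<^sup>2 * r) * X i + s * (X (Suc i) + r * (s * X i / (\<mu> - 1)))
          = X i + (r * s\<^sup>2 * X i + s * (r * (s * X i / (\<mu> - 1)))) + s * X (Suc i)"
        by (simp add: algebra_simps)
      also have "\<dots> = (1 + r * shearer_delta s \<mu> - B i) * X i"
        unfolding load up by (simp add: algebra_simps)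
      also have "1 + r * shearer_delta s \<mu> - B i = \<mu>"
        using 1 first by (simp add: r_def)
      finally show ?thesis
        using 1 unfolding deg nb by (simp add: x_def r_def)
    next
      case 2
      have "(1 + s\<^sup>2 * (1 + r)) * X i + s * (X (Suc i) + X (i - 1) + r * (s * X i / (\<mu> - 1)))
          = X i + s\<^sup>2 * X i + (r * s\<^sup>2 * X i + s * (r * (s * X i / (\<mu> - 1))))
            + s * X (Suc i) + s * X (i - 1)"
        by (simp add: algebra_simps)
      also have "\<dots> = (1 + s\<^sup>2 + r * shearer_delta s \<mu> - B i - s\<^sup>2 / B l) * X i"
        unfolding load up using down 2 by (simp add: algebra_simps)
      also have "1 + s\<^sup>2 + r * shearer_delta s \<mu> - B i - s\<^sup>2 / B l = \<mu>"
        using 2 inner[of l] by (simp add: r_def shearer_phi_def)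
      finally show ?thesis
        using 2 unfolding deg nb by (simp add: x_def r_def)
    next
      case 3
      have "(1 + s\<^sup>2 * r) * X i + s * (X (i - 1) + r * (s * X i / (\<mu> - 1)))
          = X i + (r * s\<^sup>2 * X i + s * (r * (s * X i / (\<mu> - 1)))) + s * X (i - 1)"
        by (simp add: algebra_simps)
      also have "\<dots> = (1 + r * shearer_delta s \<mu> - s\<^sup>2 / B n) * X i"
        unfolding load using down 3 by (simp add: algebra_simps)
      also have "1 + r * shearer_delta s \<mu> - s\<^sup>2 / B n = \<mu>"
        using 3 last by (simp add: r_def shearer_phi_def)
      finally show ?thesis
        using 3 unfolding deg nb by (simp add: x_def r_def)
    qed
  qed
  have verts: "pverts (caterpillar rs) = {(i, m). i < n + 2 \<and> m \<le> rs ! i}"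
    by (simp add: caterpillar_def len)
  show ?thesis
  proof (rule deformed_laplacian_radius_eqI[OF pair_graph_caterpillar, where x = x and \<sigma> = \<sigma>])
    show "pverts (caterpillar rs) \<noteq> {}" unfolding verts by force
    show "1 \<le> out_degree (with_proj (caterpillar rs)) u" if "u \<in> pverts (caterpillar rs)" for u
    proof (cases u)
      case (Pair i m)
      then have im: "i < n + 2" "m \<le> rs ! i" using that by (auto simp: verts)
      show ?thesis
      proof (cases "m = 0")
        case True
        then show ?thesis using degree_caterpillar_back[of i rs] im len Pair by auto
      next
        case False
        then show ?thesis
          using neighbours_caterpillar_leaf[of i rs m] im len Pair
          by (simp add: out_degree_eq_card_neighbours)
      qed
    qed
    show "\<sigma> w = - \<sigma> u" if "(u, w) \<in> parcs (caterpillar rs)" for u w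
      using that by (cases u; cases w) (auto simp: \<sigma>_def arc_caterpillar_iff)
    show "0 < x u" if "u \<in> pverts (caterpillar rs)" for u
      using that Xpos s \<mu> by (auto simp: verts x_def)
    show "(1 + s\<^sup>2 * (real (out_degree (with_proj (caterpillar rs)) u) - 1)) * x u
        + s * (\<Sum>w\<in>neighbours (caterpillar rs) u. x w) = \<mu> * x u"
      if "u \<in> pverts (caterpillar rs)" for u
      using that leaf_eq back_eq by (cases u; cases "snd u = 0") (simp_all add: verts)
  qed (use s \<mu> in \<open>auto simp: \<sigma>_def\<close>)
qed

section \<open>The least positive root\<close>

definition increases_to_zero :: "(real \<Rightarrow> real) \<Rightarrow> real \<Rightarrow> bool" where
  "increases_to_zero f E \<longleftrightarrow>
     0 < E \<and> continuous_on {0..E} f \<and> strict_mono_on {0..E} f \<and> f E = 0"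

lemma increases_to_zero_neg:
  assumes "increases_to_zero f E" "0 \<le> e" "e < E"
  shows "f e < 0"
  using assms strict_mono_onD[of "{0..E}" f e E] by (auto simp: increases_to_zero_def)

lemma increases_to_zero_cong:
  assumes "increases_to_zero f E" and eq: "\<And>e. 0 \<le> e \<Longrightarrow> e \<le> E \<Longrightarrow> f e = g e"
  shows "increases_to_zero g E"
proof -
  have "continuous_on {0..E} g \<longleftrightarrow> continuous_on {0..E} f"
    by (intro continuous_on_cong) (auto simp: eq)
  then show ?thesis
    using assms by (auto simp: increases_to_zero_def strict_mono_on_def)
qed

text \<open>
  As \<open>f\<close> increases to 0 through negative values, \<open>- c / f\<close> increases to infinity, while \<open>h\<close> stays
  above \<open>h 0\<close>. So the difference becomes positive before \<open>E\<close> and has a zero there.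
\<close>

lemma increases_to_zero_step:
  assumes f: "increases_to_zero f E" and c: "0 < c"
    and h: "continuous_on {0..<E} h" "mono_on {0..<E} h"
    and neg: "h 0 - c / f 0 < 0"
  shows "\<exists>E'<E. increases_to_zero (\<lambda>e. h e - c / f e) E'"
proof -
  define g where "g = (\<lambda>e. h e - c / f e)"
  note fneg = increases_to_zero_neg[OF f]
  have E: "0 < E" and fcont: "continuous_on {0..E} f" and fmono: "strict_mono_on {0..E} f"
    and fE: "f E = 0"
    using f by (auto simp: increases_to_zero_def)
  have gcont: "continuous_on {0..<E} g"
    unfolding g_def
    by (intro continuous_intros h continuous_on_subset[OF fcont]) (use fneg in force)+
  have gmono: "strict_mono_on {0..<E} g"
  proof (rule strict_mono_onI)
    fix x y assume xy: "x \<in> {0..<E}" "y \<in> {0..<E}" "x < y"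
    have "f x < f y" using strict_mono_onD[OF fmono, of x y] xy by simp
    moreover have "f y < 0" using fneg xy by auto
    ultimately have "inverse (f y) < inverse (f x)"
      by (simp add: less_imp_inverse_less_neg)
    then have "c / f y < c / f x"
      using c by (simp add: field_class.field_divide_inverse)
    moreover have "h x \<le> h y" using mono_onD[OF h(2), of x y] xy by simp
    ultimately show "g x < g y" by (simp add: g_def)
  qed
  \<comment> \<open>Where \<open>f = - \<eta>\<close>, the term \<open>- c / f\<close> equals
      \<open>\<bar>h 0\<bar> + 1\<close>, which outweighs \<open>h\<close>.\<close>
  define \<eta> where "\<eta> = c / (\<bar>h 0\<bar> + 1)"
  have \<eta>: "\<eta> > 0" using c by (simp add: \<eta>_def)
  have c\<eta>: "c / \<eta> = \<bar>h 0\<bar> + 1" using c by (simp add: \<eta>_def)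
  have "f 0 \<le> -\<eta>"
  proof (rule ccontr)
    assume "\<not> f 0 \<le> - \<eta>"
    then have "c / \<eta> < c / - f 0"
      using fneg[of 0] E c by (intro divide_strict_left_mono) (auto intro: mult_pos_neg)
    then show False using neg c\<eta> by simp
  qed
  then obtain z where z: "0 \<le> z" "z \<le> E" "f z = - \<eta>"
    using IVT'[OF _ _ _ fcont, of "-\<eta>"] fE \<eta> E by auto
  have zE: "z < E" using z fE \<eta> by (cases "z = E") auto
  have "h 0 \<le> h z" using mono_onD[OF h(2), of 0 z] z zE E by simp
  then have "g z > 0" using c\<eta> z by (simp add: g_def)
  moreover have "continuous_on {0..z} g"
    using zE by (intro continuous_on_subset[OF gcont]) auto
  moreover have "g 0 < 0" using neg by (simp add: g_def)
  ultimately obtain E' where E': "0 \<le> E'" "E' \<le> z" "g E' = 0"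
    using IVT'[of g 0 0 z] z(1) by auto
  have "E' \<noteq> 0" using neg E' by (auto simp: g_def)
  have sub: "{0..E'} \<subseteq> {0..<E}" using E' zE by auto
  have "increases_to_zero g E'"
    using E' \<open>E' \<noteq> 0\<close> continuous_on_subset[OF gcont sub] monotone_on_subset[OF gmono sub]
    by (auto simp: increases_to_zero_def)
  then show ?thesis using E' zE unfolding g_def by (intro exI[of _ E']) auto
qed

lemma shearer_delta_eq:
  "lam \<noteq> 1 \<Longrightarrow> shearer_delta s lam = s\<^sup>2 + s\<^sup>2 / (lam - 1)"
  by (simp add: shearer_delta_def field_simps)

lemma continuous_mono_load:
  assumes "E \<le> lam - 1" "0 \<le> r"
  shows "continuous_on {0..<E} (\<lambda>e. C + e + r * shearer_delta s (lam - e))"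
    and "mono_on {0..<E} (\<lambda>e. C + e + r * shearer_delta s (lam - e))"
proof -
  show "continuous_on {0..<E} (\<lambda>e. C + e + r * shearer_delta s (lam - e))"
    unfolding shearer_delta_def using assms by (intro continuous_intros) auto
  show "mono_on {0..<E} (\<lambda>e. C + e + r * shearer_delta s (lam - e))"
  proof (rule mono_onI)
    fix x y assume xy: "x \<in> {0..<E}" "y \<in> {0..<E}" "x \<le> y"
    then have "s\<^sup>2 / (lam - x - 1) \<le> s\<^sup>2 / (lam - y - 1)"
      using assms by (intro divide_left_mono mult_pos_pos) auto
    then have "shearer_delta s (lam - x) \<le> shearer_delta s (lam - y)"
      using assms xy by (subst (1 2) shearer_delta_eq) auto
    then have "r * shearer_delta s (lam - x) \<le> r * shearer_delta s (lam - y)"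
      using assms(2) by (rule mult_left_mono)
    then show "C + x + r * shearer_delta s (lam - x) \<le> C + y + r * shearer_delta s (lam - y)"
      using xy by simp
  qed
qed

lemma shearer_b_eps_0: "shearer_b_eps s lam j 0 = shearer_b s lam j"
  by (induction j rule: induct_nat_012) auto

lemma shearer_b_neg:
  assumes "lam > 1" "0 < s" "s < sqrt lam - 1" "j \<ge> 1"
  shows "shearer_b s lam j < 0"
  using shearer_b_le_theta'[OF assms(1-3), of "j - 1"] shearer_theta'_bounds(2)[OF assms(1-3)]
    assms(4) by simp

lemma shearer_b_last_0_neg:
  assumes "lam > 1" "0 < s" "s < sqrt lam - 1"
  shows "shearer_b_last s lam k 0 < 0"
proof -
  have "of_int (shearer_r_end s lam k)
      \<le> (shearer_theta' s lam - shearer_phi s lam (shearer_b s lam (k - 1)) + s\<^sup>2)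
        / shearer_delta s lam"
    unfolding shearer_r_end_def by (rule of_int_floor_le)
  then have "shearer_b_last s lam k 0 \<le> shearer_theta' s lam"
    using shearer_delta_pos[OF assms(1,2)]
    by (simp add: shearer_b_last_def shearer_b_eps_0 pos_le_divide_eq)
  then show ?thesis using shearer_theta'_bounds(2)[OF assms] by simp
qed

text \<open>
  The bound \<open>E \<le> lam - 1\<close> keeps the interval to the left of the pole of \<open>\<delta>(\<epsilon>)\<close>. It is attained only
  if \<open>j = 1\<close> and \<open>r\<^sub>1 = 0\<close>, in which case the first function is \<open>1 - lam + \<epsilon>\<close>.
\<close>

lemma shearer_b_eps_increases_to_zero:
  assumes "lam > 1" "0 < s" "s < sqrt lam - 1" "j \<ge> 1"
  shows "\<exists>E\<le>lam - 1. increases_to_zero (shearer_b_eps s lam j) E \<and>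
           (\<forall>i\<in>{1..j}. \<forall>e\<in>{0..<E}. shearer_b_eps s lam i e < 0)"
  using assms(4)
proof (induction j rule: nat_induct_at_least)
  case base
  define r where "r = real_of_int (shearer_r s lam 1)"
  have r: "r \<ge> 0" unfolding r_def of_int_0_le_iff by (rule shearer_r_nonneg[OF assms(1-3)])
  have leaf: "increases_to_zero (\<lambda>e. 1 - lam + e) (lam - 1)"
    using assms(1) by (auto simp: increases_to_zero_def strict_mono_on_def intro!: continuous_intros)
  have b1: "shearer_b_eps s lam 1 = (\<lambda>e. 1 - lam + e + r * shearer_delta s (lam - e))"
    by (auto simp: r_def)
  have "\<exists>E\<le>lam - 1. increases_to_zero (shearer_b_eps s lam 1) E"
  proof (cases "r = 0")
    case True
    then show ?thesis using leaf b1 by auto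
  next
    case False
    have c: "r * s\<^sup>2 > 0" using False r assms(2) by simp
    \<comment> \<open>The pivot of a pendant vertex, \<open>1 - lam + \<epsilon>\<close>, plays the
        role of the preceding function: \<open>r \<delta>(\<epsilon>) = r s\<^sup>2 - r s\<^sup>2 /
        (1 - lam + \<epsilon>)\<close>.\<close>
    have eq: "1 - lam + r * s\<^sup>2 + e - r * s\<^sup>2 / (1 - lam + e) = shearer_b_eps s lam 1 e"
      if "e < lam - 1" for e
      using that unfolding b1 by (subst shearer_delta_eq) (auto simp: field_simps)
    have neg: "1 - lam + r * s\<^sup>2 + 0 - r * s\<^sup>2 / (1 - lam + 0) < 0"
      using shearer_b_neg[OF assms(1-3), of 1] eq[of 0] assms(1)
      by (simp add: shearer_b_eps_0)
    have "mono_on {0..<lam - 1} (\<lambda>e. 1 - lam + r * s\<^sup>2 + e)" by (rule mono_onI) simp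
    moreover have "continuous_on {0..<lam - 1} (\<lambda>e. 1 - lam + r * s\<^sup>2 + e)"
      by (intro continuous_intros)
    ultimately have "\<exists>E<lam - 1.
        increases_to_zero (\<lambda>e. 1 - lam + r * s\<^sup>2 + e - r * s\<^sup>2 / (1 - lam + e)) E"
      using neg by (intro increases_to_zero_step[OF leaf c]) auto
    then obtain E where E: "E < lam - 1"
      "increases_to_zero (\<lambda>e. 1 - lam + r * s\<^sup>2 + e - r * s\<^sup>2 / (1 - lam + e)) E"
      by auto
    have "increases_to_zero (shearer_b_eps s lam 1) E"
      by (rule increases_to_zero_cong[OF E(2)]) (rule eq, use E(1) in linarith)
    then show ?thesis using E(1) by (intro exI[of _ E]) simp
  qed
  then show ?case using increases_to_zero_neg by fastforce
next
  case (Suc j)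
  then obtain E where E: "E \<le> lam - 1" "increases_to_zero (shearer_b_eps s lam j) E"
    "\<forall>i\<in>{1..j}. \<forall>e\<in>{0..<E}. shearer_b_eps s lam i e < 0" by auto
  define r where "r = real_of_int (shearer_r s lam (Suc j))"
  have r: "r \<ge> 0" unfolding r_def of_int_0_le_iff by (rule shearer_r_nonneg[OF assms(1-3)])
  have b: "shearer_b_eps s lam (Suc j) =
      (\<lambda>e. (1 + s\<^sup>2 - lam) + e + r * shearer_delta s (lam - e) - s\<^sup>2 / shearer_b_eps s lam j e)"
    using \<open>j \<ge> 1\<close> by (cases j) (auto simp: shearer_phi_def r_def)
  have neg: "(1 + s\<^sup>2 - lam) + 0 + r * shearer_delta s (lam - 0) - s\<^sup>2 / shearer_b_eps s lam j 0 < 0"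
    using shearer_b_neg[OF assms(1-3), of "Suc j"] shearer_b_eps_0[of s lam "Suc j"] by (simp add: b)
  obtain E' where E': "E' < E" "increases_to_zero (shearer_b_eps s lam (Suc j)) E'"
    using increases_to_zero_step[OF E(2) _ continuous_mono_load[OF E(1) r] neg] assms(2)
    unfolding b by auto
  have "shearer_b_eps s lam i e < 0" if "i \<in> {1..Suc j}" "e \<in> {0..<E'}" for i e
    using that E(3) E'(1) increases_to_zero_neg[OF E'(2)] by (cases "i = Suc j") auto
  then show ?case using E' E(1) by (intro exI[of _ E']) auto
qed

text \<open>
  The function at the last back node is strictly increasing up to its first zero, so nothing before
  that zero is a root; and since the first zeros of the earlier functions lie further to the right,
  the zero is a genuine root and not an artefact of a division by zero.
\<close>

lemma shearer_eps_least_root: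
  assumes "lam > 1" "0 < s" "s < sqrt lam - 1" "k \<ge> 2"
  shows "0 < shearer_eps s lam k" "shearer_eps s lam k < lam - 1"
    "shearer_b_last s lam k (shearer_eps s lam k) = 0"
    "\<And>j. j \<in> {1..<k} \<Longrightarrow> shearer_b_eps s lam j (shearer_eps s lam k) < 0"
proof -
  obtain E where E: "E \<le> lam - 1" "increases_to_zero (shearer_b_eps s lam (k - 1)) E"
    "\<forall>i\<in>{1..k-1}. \<forall>e\<in>{0..<E}. shearer_b_eps s lam i e < 0"
    using shearer_b_eps_increases_to_zero[OF assms(1-3), of "k - 1"] assms(4)
    by (metis add_le_imp_le_diff one_add_one)
  define r where "r = real_of_int (shearer_r_end s lam k)"
  have r: "r \<ge> 0" using shearer_r_end_nonneg[OF assms] by (simp add: r_def)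
  have b: "shearer_b_last s lam k =
      (\<lambda>e. (1 - lam) + e + r * shearer_delta s (lam - e) - s\<^sup>2 / shearer_b_eps s lam (k - 1) e)"
    by (auto simp: shearer_b_last_def shearer_phi_def r_def)
  have neg: "(1 - lam) + 0 + r * shearer_delta s (lam - 0)
      - s\<^sup>2 / shearer_b_eps s lam (k - 1) 0 < 0"
    using shearer_b_last_0_neg[OF assms(1-3), of k] by (simp add: b)
  obtain E' where E': "E' < E" "increases_to_zero (shearer_b_last s lam k) E'"
    using increases_to_zero_step[OF E(2) _ continuous_mono_load[OF E(1) r] neg] assms(2)
    unfolding b by auto
  have pos: "0 < E'" and root: "shearer_b_last s lam k E' = 0"
    using E'(2) by (auto simp: increases_to_zero_def)
  have negE': "shearer_b_eps s lam j E' < 0" if "j \<in> {1..<k}" for j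
    using E(3) E'(1) pos that by auto
  have "shearer_eps s lam k = E'"
    unfolding shearer_eps_def
  proof (rule Least_equality)
    show "0 < E' \<and> shearer_b_last_root s lam k E'"
      using pos root negE' E' E(1) by (fastforce simp: shearer_b_last_root_def)
    show "E' \<le> e" if "0 < e \<and> shearer_b_last_root s lam k e" for e
      using that increases_to_zero_neg[OF E'(2), of e] by (force simp: shearer_b_last_root_def)
  qed
  then show "0 < shearer_eps s lam k" "shearer_eps s lam k < lam - 1"
    "shearer_b_last s lam k (shearer_eps s lam k) = 0"
    "\<And>j. j \<in> {1..<k} \<Longrightarrow> shearer_b_eps s lam j (shearer_eps s lam k) < 0"
    using pos root negE' E' E(1) by auto
qed

section \<open>Tangents and the sequence of slopes\<close>

lemma shearer_c_gamma_pos: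
  assumes "lam > 1" "0 < s" "s < sqrt lam - 1"
  shows "j \<ge> 1 \<Longrightarrow> shearer_c s lam j > 0" "j \<ge> 2 \<Longrightarrow> shearer_gamma s lam j > 0"
proof -
  show "shearer_c s lam j > 0" if "j \<ge> 1"
  proof -
    have "0 \<le> real_of_int (shearer_r s lam j) * s\<^sup>2 * (1 / (lam - 1)\<^sup>2)"
      using shearer_r_nonneg[OF assms] by simp
    then show ?thesis
      using shearer_b_neg[OF assms that] unfolding shearer_c_def
      by (intro divide_pos_pos) linarith+
  qed
  show "shearer_gamma s lam j > 0" if "j \<ge> 2"
    using shearer_b_neg[OF assms, of "j - 1"] shearer_b_neg[OF assms, of j] that assms(2)
    by (simp add: shearer_gamma_def mult_neg_neg)
qed

lemma shearer_beta_1: "shearer_beta s lam (Suc 0) = shearer_c s lam (Suc 0)"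
  by (simp add: shearer_c_def)

lemma shearer_beta_pos:
  assumes "lam > 1" "0 < s" "s < sqrt lam - 1" "j \<ge> 1"
  shows "shearer_beta s lam j > 0"
  using assms(4)
proof (induction j rule: nat_induct_at_least)
  case base
  then show ?case using shearer_c_gamma_pos(1)[OF assms(1-3), of 1] shearer_beta_1 by simp
next
  case (Suc j)
  then show ?case
    using shearer_c_gamma_pos[OF assms(1-3), of "Suc j"] by (cases j) (auto intro: add_pos_pos)
qed

text \<open>
  The tangent at \<open>\<epsilon> = 0\<close> of the convex function \<open>\<epsilon> \<mapsto> \<delta>(\<epsilon>)\<close>.
\<close>

lemma shearer_delta_tangent:
  assumes "0 \<le> e" "e < lam - 1"
  shows "shearer_delta s lam + e * (s\<^sup>2 * (1 / (lam - 1)\<^sup>2)) \<le> shearer_delta s (lam - e)"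
proof -
  define a where "a = lam - 1"
  have a: "a > e" "a > 0" using assms by (auto simp: a_def)
  have "(a + e) * (a - e) \<le> a\<^sup>2"
    by (simp add: power2_eq_square algebra_simps)
  then have "(a + e) / a\<^sup>2 \<le> 1 / (a - e)"
    using a by (simp add: field_simps)
  then have "1 / a + e * (1 / a\<^sup>2) \<le> 1 / (a - e)"
    using a by (simp add: field_simps power2_eq_square)
  then have "s\<^sup>2 * (1 / a + e * (1 / a\<^sup>2)) \<le> s\<^sup>2 * (1 / (a - e))"
    by (rule mult_left_mono) simp
  then show ?thesis
    using assms a by (subst (1 2) shearer_delta_eq) (auto simp: a_def algebra_simps)
qed

text \<open>
  The left-hand side is the tangent of \<open>b\<^sub>j(\<epsilon>)\<close> at 0, since \<open>\<beta>\<^sub>j = b\<^sub>j'(0) / (- b\<^sub>j(0))\<close>; the recursion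
  defining \<open>\<beta>\<close> is the chain rule. The bound passes from \<open>b\<^sub>j\<close> to \<open>b\<^sub>j\<^sub>+\<^sub>1\<close> because \<open>t \<mapsto> - s\<^sup>2 / t\<close> is
  increasing and convex for negative \<open>t\<close>.
\<close>

lemma shearer_b_eps_tangent:
  assumes "lam > 1" "0 < s" "s < sqrt lam - 1" "j \<ge> 1"
    and e: "0 \<le> e" "e < lam - 1" "\<And>i. i \<in> {1..j} \<Longrightarrow> shearer_b_eps s lam i e < 0"
  shows "shearer_b s lam j * (1 - e * shearer_beta s lam j) \<le> shearer_b_eps s lam j e"
proof -
  have affine: "x * (1 - e * y) = x + e * K" if "x * y = - K" for x y K :: real
  proof -
    have "x * (1 - e * y) = x - e * (x * y)" by (simp add: algebra_simps)
    then show ?thesis by (simp add: that)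
  qed
  show ?thesis
  using assms(4) e(3)
proof (induction j rule: nat_induct_at_least)
  case base
  define r where "r = real_of_int (shearer_r s lam 1)"
  have r: "r \<ge> 0" unfolding r_def of_int_0_le_iff by (rule shearer_r_nonneg[OF assms(1-3)])
  have bneg: "shearer_b s lam 1 < 0" by (rule shearer_b_neg[OF assms(1-3)]) simp
  have load: "r * (shearer_delta s lam + e * (s\<^sup>2 * (1 / (lam - 1)\<^sup>2))) \<le> r * shearer_delta s (lam - e)"
    using shearer_delta_tangent[OF e(1,2)] r by (rule mult_left_mono)
  have "shearer_b s lam 1 * shearer_beta s lam 1 = - (1 + r * s\<^sup>2 * (1 / (lam - 1)\<^sup>2))"
    using bneg shearer_beta_1[of s lam]
    by (simp add: shearer_c_def r_def del: shearer_beta.simps shearer_b.simps shearer_r.simps)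
  then have "shearer_b s lam 1 * (1 - e * shearer_beta s lam 1)
      = shearer_b s lam 1 + e * (1 + r * s\<^sup>2 * (1 / (lam - 1)\<^sup>2))"
    by (rule affine)
  moreover have "shearer_b_eps s lam 1 e = 1 - lam + e + r * shearer_delta s (lam - e)"
    by (simp add: r_def)
  moreover have "shearer_b s lam 1 = 1 - lam + r * shearer_delta s lam"
    by (simp add: r_def)
  ultimately show ?case using load by (simp only:) (simp add: algebra_simps)
next
  case (Suc j)
  define r where "r = real_of_int (shearer_r s lam (Suc j))"
  define \<beta> where "\<beta> = shearer_beta s lam j"
  define U where "U = - shearer_b s lam j"
  define u where "u = - shearer_b_eps s lam j e"
  have r: "r \<ge> 0" unfolding r_def of_int_0_le_iff by (rule shearer_r_nonneg[OF assms(1-3)])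
  have bneg: "shearer_b s lam (Suc j) < 0" by (rule shearer_b_neg[OF assms(1-3)]) simp
  have U: "U > 0" using shearer_b_neg[OF assms(1-3)] Suc by (simp add: U_def)
  have u: "u > 0" using Suc by (simp add: u_def)
  have "u \<le> U * (1 - e * \<beta>)" using Suc by (simp add: u_def U_def \<beta>_def)
  then have x: "1 - e * \<beta> > 0" using u U by (metis less_le_trans zero_less_mult_pos)
  \<comment> \<open>This is \<open>1 / (1 - x) \<ge> 1 + x\<close> for \<open>x = e \<beta> <
      1\<close>.\<close>
  have "u * (1 + e * \<beta>) \<le> U"
  proof (cases "1 + e * \<beta> \<ge> 0")
    case True
    have "u * (1 + e * \<beta>) \<le> U * (1 - e * \<beta>) * (1 + e * \<beta>)"
      using \<open>u \<le> _\<close> True by (rule mult_right_mono)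
    also have "\<dots> = U * (1 - (e * \<beta>)\<^sup>2)" by (simp add: power2_eq_square algebra_simps)
    also have "\<dots> \<le> U * 1" using U by (intro mult_left_mono) auto
    finally show ?thesis by simp
  next
    case False
    then have "u * (1 + e * \<beta>) < 0" using u by (simp add: mult_pos_neg)
    then show ?thesis using U by simp
  qed
  then have "(1 + e * \<beta>) / U \<le> 1 / u" using u U by (simp add: field_simps)
  then have "s\<^sup>2 * ((1 + e * \<beta>) / U) \<le> s\<^sup>2 * (1 / u)" by (rule mult_left_mono) simp
  then have 1: "s\<^sup>2 / U + e * (s\<^sup>2 * \<beta> / U) \<le> s\<^sup>2 / u"
    by (simp add: distrib_left add_divide_distrib mult_ac)
  have 2: "r * (shearer_delta s lam + e * (s\<^sup>2 * (1 / (lam - 1)\<^sup>2))) \<le> r * shearer_delta s (lam - e)"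
    using shearer_delta_tangent[OF e(1,2)] r by (rule mult_left_mono)
  have be: "shearer_b_eps s lam (Suc j) e
      = 1 + s\<^sup>2 - lam + e + s\<^sup>2 / u + r * shearer_delta s (lam - e)"
    using \<open>j \<ge> 1\<close> by (cases j) (auto simp: shearer_phi_def r_def u_def)
  have b: "shearer_b s lam (Suc j) = 1 + s\<^sup>2 - lam + s\<^sup>2 / U + r * shearer_delta s lam"
    using \<open>j \<ge> 1\<close> by (cases j) (auto simp: shearer_phi_def r_def U_def)
  have "shearer_beta s lam (Suc j)
      = shearer_c s lam (Suc j) + shearer_gamma s lam (Suc j) * \<beta>"
    using \<open>j \<ge> 1\<close> by (cases j) (auto simp: \<beta>_def)
  then have "shearer_b s lam (Suc j) * shearer_beta s lam (Suc j)
      = - (1 + r * s\<^sup>2 * (1 / (lam - 1)\<^sup>2) + s\<^sup>2 * \<beta> / U)"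
    using bneg U
    by (simp add: shearer_c_def shearer_gamma_def r_def U_def right_diff_distrib
        del: shearer_b.simps shearer_r.simps)
  then have "shearer_b s lam (Suc j) * (1 - e * shearer_beta s lam (Suc j))
     = shearer_b s lam (Suc j) + e * (1 + r * s\<^sup>2 * (1 / (lam - 1)\<^sup>2) + s\<^sup>2 * \<beta> / U)"
    by (rule affine)
  then show ?case using 1 2 unfolding be b by (simp add: algebra_simps)
qed
qed

lemma shearer_eps_mult_beta_less_1:
  assumes "lam > 1" "0 < s" "s < sqrt lam - 1" "1 \<le> j" "j < k"
  shows "shearer_eps s lam k * shearer_beta s lam j < 1"
proof -
  have k: "k \<ge> 2" using assms by simp
  note root = shearer_eps_least_root[OF assms(1-3) k]
  have "shearer_b s lam j * (1 - shearer_eps s lam k * shearer_beta s lam j)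
      \<le> shearer_b_eps s lam j (shearer_eps s lam k)"
    using assms root by (intro shearer_b_eps_tangent) auto
  also have "\<dots> < 0" using root(4) assms by simp
  finally show ?thesis
    using shearer_b_neg[OF assms(1-4)] by (simp add: mult_less_0_iff)
qed

section \<open>The spectral radius of the Shearer caterpillars\<close>

lemma deformed_laplacian_radius_shearer:
  assumes "lam > 1" "0 < s" "s < sqrt lam - 1" "k \<ge> 2"
  shows "deformed_laplacian_radius (shearer_caterpillar s lam k) s = lam - shearer_eps s lam k"
proof -
  define n where "n = k - 2"
  have k: "k = n + 2" using assms(4) by (simp add: n_def)
  define e where "e = shearer_eps s lam k"
  note root = shearer_eps_least_root[OF assms, folded e_def]
  define rs where "rs = map (\<lambda>j. nat (shearer_r s lam j)) [1..<k] @ [nat (shearer_r_end s lam k)]"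
  have r: "real (rs ! i) = of_int (shearer_r s lam (Suc i))" if "i \<le> n" for i
    using that shearer_r_nonneg[OF assms(1-3), of "Suc i"]
    by (simp add: rs_def k nth_append del: upt_Suc shearer_r.simps)
  have r_end: "real (rs ! Suc n) = of_int (shearer_r_end s lam k)"
    using shearer_r_end_nonneg[OF assms] by (simp add: rs_def k nth_append del: upt_Suc)
  have "deformed_laplacian_radius (caterpillar rs) s = lam - e"
  proof (rule deformed_laplacian_radius_caterpillar_eqI[
        where B = "\<lambda>i. shearer_b_eps s lam (Suc i) e" and n = n])
    show "shearer_b_eps s lam (Suc 0) e = 1 - (lam - e) + real (rs ! 0) * shearer_delta s (lam - e)"
      by (simp add: r)
    show "shearer_b_eps s lam (Suc (Suc i)) e = shearer_phi s (lam - e) (shearer_b_eps s lam (Suc i) e)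
        + real (rs ! Suc i) * shearer_delta s (lam - e)" if "i < n" for i
      using that by (simp only: r[of "Suc i"] Suc_leI shearer_b_eps.simps)
    show "shearer_b_eps s lam (Suc i) e < 0" if "i \<le> n" for i
      using that root(4)[of "Suc i"] k by simp
    show "- s\<^sup>2 + shearer_phi s (lam - e) (shearer_b_eps s lam (Suc n) e)
        + real (rs ! Suc n) * shearer_delta s (lam - e) = 0"
      using root(3) unfolding shearer_b_last_def r_end by (simp add: k)
  qed (use assms root in \<open>simp_all add: rs_def k\<close>)
  then show ?thesis by (simp add: shearer_caterpillar_def rs_def e_def)
qed

lemma shearer_eps_tendsto_0:
  assumes "lam > 1" "0 < s" "s < sqrt lam - 1"
    and unbounded: "\<not> bounded (shearer_beta s lam ` {1..})"
  shows "shearer_eps s lam \<longlonglongrightarrow> 0"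
proof (rule LIMSEQ_I)
  fix \<eta> :: real assume \<eta>: "0 < \<eta>"
  have "\<not> (\<forall>y\<in>shearer_beta s lam ` {1..}. norm y \<le> 1 / \<eta>)"
    using unbounded unfolding bounded_iff by blast
  then obtain j where j: "j \<ge> 1" "\<bar>shearer_beta s lam j\<bar> > 1 / \<eta>"
    by (auto simp: not_le)
  have \<beta>: "1 < \<eta> * shearer_beta s lam j"
    using j(2) \<eta> shearer_beta_pos[OF assms(1-3) j(1)] by (simp add: divide_less_eq mult.commute)
  have "norm (shearer_eps s lam k - 0) < \<eta>" if "k \<ge> Suc j" for k
  proof -
    have "shearer_eps s lam k * shearer_beta s lam j < \<eta> * shearer_beta s lam j"
      using shearer_eps_mult_beta_less_1[OF assms(1-3) j(1), of k] that \<beta> by simp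
    then have "shearer_eps s lam k < \<eta>"
      using shearer_beta_pos[OF assms(1-3) j(1)] by simp
    then show ?thesis
      using shearer_eps_least_root(1)[OF assms(1-3), of k] j(1) that by simp
  qed
  then show "\<exists>N. \<forall>k\<ge>N. norm (shearer_eps s lam k - 0) < \<eta>" by blast
qed

theorem theorem9:
  fixes lam s :: real
  assumes "lam > 1" and "0 < s" and "s < sqrt lam - 1"
  shows
    "((\<lambda>k. deformed_laplacian_radius (shearer_caterpillar s lam k) s) \<longlonglongrightarrow> lam
        \<longleftrightarrow> shearer_eps s lam \<longlonglongrightarrow> 0)
     \<and> (\<forall>j\<ge>2. shearer_c s lam j > 0 \<and> shearer_gamma s lam j > 0)
     \<and> (\<not> bounded (shearer_beta s lam ` {1..})
        \<longrightarrow> shearer_eps s lam \<longlonglongrightarrow> 0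
          \<and> (\<lambda>k. deformed_laplacian_radius (shearer_caterpillar s lam k) s) \<longlonglongrightarrow> lam)"
proof -
  let ?\<rho> = "\<lambda>k. deformed_laplacian_radius (shearer_caterpillar s lam k) s"
  have \<rho>: "\<forall>\<^sub>F k in sequentially. ?\<rho> k = lam - shearer_eps s lam k"
    using deformed_laplacian_radius_shearer[OF assms]
    by (intro eventually_sequentiallyI[of 2]) simp
  have "(\<lambda>k. lam - shearer_eps s lam k) \<longlonglongrightarrow> lam \<longleftrightarrow> shearer_eps s lam \<longlonglongrightarrow> 0"
  proof
    assume "(\<lambda>k. lam - shearer_eps s lam k) \<longlonglongrightarrow> lam"
    then have "(\<lambda>k. lam - (lam - shearer_eps s lam k)) \<longlonglongrightarrow> lam - lam"
      by (intro tendsto_intros)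
    then show "shearer_eps s lam \<longlonglongrightarrow> 0" by simp
  next
    assume "shearer_eps s lam \<longlonglongrightarrow> 0"
    then have "(\<lambda>k. lam - shearer_eps s lam k) \<longlonglongrightarrow> lam - 0"
      by (intro tendsto_intros)
    then show "(\<lambda>k. lam - shearer_eps s lam k) \<longlonglongrightarrow> lam" by simp
  qed
  then have "?\<rho> \<longlonglongrightarrow> lam \<longleftrightarrow> shearer_eps s lam \<longlonglongrightarrow> 0"
    using tendsto_cong[OF \<rho>] by simp
  then show ?thesis
    using shearer_c_gamma_pos[OF assms] shearer_eps_tendsto_0[OF assms] by simp
qed

end
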